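(* Let $n\geq 2$ and let $R\cong F_1\times F_2\times\cdots\times F_n$, where $F_1,\dots,F_n$ are finite fields. If there exist indices $1\leq i<j\leq n$ such that $|U''(F_i)|>0$ and $|U''(F_j)|>0$, then $\Gamma'_{Reg}(R)$ is a non-planar graph.
   Context: For a field $F$, $U''(F)$ denotes the set of units $a\in F$ with $a^{-1}\neq a$. For a commutative von Neumann regular ring $R$ with identity (i.e. for every $x\in R$ there is $y\in R$ with $xyx=x$; finite products of fields are such rings), $\Gamma'_{Reg}(R)$ is the simple graph with vertex set $R\setminus\{0_R\}$ in which two distinct vertices $a,b$ are adjacent if and only if $aba=a$ or $bab=b$. *)

theory Defs
  imports
    "HOL-Analysis.Path_Connected"
    "HOL-Algebra.Chinese_Remainder"
begin

text \<open>Simple graphs: every edge is a set of two distinct vertices.\<close>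

record 'a sgraph =
  verts :: "'a set"
  edges :: "'a set set"

definition simple_graph :: "'a sgraph \<Rightarrow> bool" where
  "simple_graph G \<longleftrightarrow> (\<forall>e \<in> edges G. e \<subseteq> verts G \<and> card e = 2)"

text \<open>
  A drawing in the plane without crossings, with \<^typ>\<open>complex\<close> as the plane. Vertices are
  distinct points (\<open>p\<close>); an edge is an injective curve (\<open>c\<close>) between its two end points, in
  either direction. An edge contains no vertex other than its end points, and distinct edges
  meet at most in common end points.
\<close>

definition plane_drawing ::
    "'a sgraph \<Rightarrow> ('a \<Rightarrow> complex) \<Rightarrow> ('a set \<Rightarrow> real \<Rightarrow> complex) \<Rightarrow> bool" where
  "plane_drawing G p c \<longleftrightarrow>
     inj_on p (verts G) \<and>
     (\<forall>e \<in> edges G. arc (c e) \<and> {pathstart (c e), pathfinish (c e)} = p ` e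
        \<and> path_image (c e) \<inter> p ` verts G = p ` e) \<and>
     (\<forall>e \<in> edges G. \<forall>f \<in> edges G. e \<noteq> f \<longrightarrow>
        path_image (c e) \<inter> path_image (c f) \<subseteq> p ` (e \<inter> f))"

definition planar :: "'a sgraph \<Rightarrow> bool" where
  "planar G \<longleftrightarrow> (\<exists>p c. plane_drawing G p c)"

definition U2 :: "('a, 'm) ring_scheme \<Rightarrow> 'a set" where
  "U2 F = {a \<in> Units F. inv\<^bsub>F\<^esub> a \<noteq> a}"

definition Reg_graph :: "('a, 'm) ring_scheme \<Rightarrow> 'a sgraph" where
  "Reg_graph R = \<lparr> verts = carrier R - {\<zero>\<^bsub>R\<^esub>},
     edges = {{a, b} | a b. a \<in> carrier R - {\<zero>\<^bsub>R\<^esub>} \<and> b \<in> carrier R - {\<zero>\<^bsub>R\<^esub>} \<and> a \<noteq> b \<and>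
                (a \<otimes>\<^bsub>R\<^esub> b \<otimes>\<^bsub>R\<^esub> a = a \<or> b \<otimes>\<^bsub>R\<^esub> a \<otimes>\<^bsub>R\<^esub> b = b)} \<rparr>"

lemma simple_graph_Reg_graph: "simple_graph (Reg_graph R)"
  unfolding simple_graph_def Reg_graph_def by (auto simp: card_insert_if)

end

theory Submission
  imports Defs "HOL-Analysis.Jordan_Curve"
begin

text \<open>
  Take non-involutive units \<open>u\<close>, \<open>v\<close> of the two fields, with inverses \<open>u'\<close>, \<open>v'\<close>. The elements
  whose only nonzero coordinates are \<open>u\<close> or \<open>u'\<close> in the first field and \<open>v\<close> or \<open>v'\<close> in the
  second contain the 8-cycle
  \<open>(u, 0), (u', v'), (0, v), (u, v'), (u', 0), (u, v), (0, v'), (u', v)\<close>,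
  in which opposite elements are adjacent. In a plane drawing the cycle becomes a Jordan curve,
  and of three diagonals two lie on the same side of it. This is impossible on the inside,
  because one diagonal splits the inside into two regions (theta curve) and separates the ends
  of the other; an inversion centred at an inner point reduces the outside to the inside.
\<close>

section \<open>Arcs in the plane\<close>

text \<open>Only the point set and the two ends are kept, because \<open>inside\<close> and
  \<open>outside\<close> speak of sets. Forgetting the parametrisation also makes the ends
  interchangeable.\<close>

definition arc_between :: "complex set \<Rightarrow> complex \<Rightarrow> complex \<Rightarrow> bool" where
  "arc_between S a b \<longleftrightarrow> (\<exists>g. arc g \<and> path_image g = S \<and> pathstart g = a \<and> pathfinish g = b)"

lemma arc_between_sym: "arc_between S a b \<Longrightarrow> arc_between S b a"
  unfolding arc_between_def
  by (metis arc_reversepath path_image_reversepath pathstart_reversepath pathfinish_reversepath)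

lemma arc_between_join:
  assumes "arc_between S a b" "arc_between T b c" "S \<inter> T \<subseteq> {b}"
  shows "arc_between (S \<union> T) a c"
  using assms unfolding arc_between_def
  by (metis arc_join path_image_join pathstart_join pathfinish_join)

lemma arc_between_ends:
  assumes "arc_between S a b"
  shows "a \<noteq> b" "a \<in> S" "b \<in> S"
  using assms arc_distinct_ends pathstart_in_path_image pathfinish_in_path_image
  unfolding arc_between_def by blast+

lemma arc_between_compact: "arc_between S a b \<Longrightarrow> compact S"
  unfolding arc_between_def using compact_arc_image by blast

lemma arc_between_connected_endless: "arc_between S a b \<Longrightarrow> connected (S - {a, b})"
  unfolding arc_between_def using connected_simple_path_endless arc_imp_simple_path by blast

lemma arc_between_endless_nonempty: "arc_between S a b \<Longrightarrow> S - {a, b} \<noteq> {}"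
  unfolding arc_between_def using nonempty_simple_path_endless arc_imp_simple_path by blast

text \<open>The set is the image of the half-open interval \<open>{0<..1}\<close>. Since the end
  \<open>b\<close> is kept, the position of \<open>b\<close> relative to a closed curve that the set
  avoids decides the side of the whole set.\<close>

lemma arc_between_connected_half_open:
  assumes "arc_between S a b"
  shows "connected (S - {a})"
proof -
  obtain g where g: "arc g" "path_image g = S" "pathstart g = a"
    using assms unfolding arc_between_def by blast
  have "S - {a} = g ` {0<..1}"
  proof
    show "S - {a} \<subseteq> g ` {0<..1}"
      using g unfolding path_image_def pathstart_def
      by (force simp: less_le)
    show "g ` {0<..1} \<subseteq> S - {a}"
      using g unfolding path_image_def pathstart_def arc_def inj_on_def by fastforce
  qed
  moreover have "continuous_on {0<..1} g"
    using g(1) unfolding arc_def path_def by (rule_tac continuous_on_subset) auto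
  ultimately show ?thesis
    using connected_continuous_image by (metis connected_Ioc)
qed

lemma arc_between_image:
  assumes "arc_between S a b" "continuous_on S f" "inj_on f S"
  shows "arc_between (f ` S) (f a) (f b)"
proof -
  obtain g where g: "arc g" "path_image g = S" "pathstart g = a" "pathfinish g = b"
    using assms(1) unfolding arc_between_def by blast
  have "arc (f \<circ> g)"
    using g assms(2,3) unfolding arc_def path_image_def
    by (metis comp_inj_on path_continuous_image path_image_def)
  then show ?thesis
    unfolding arc_between_def
    by (metis g(2-4) path_image_compose pathstart_compose pathfinish_compose)
qed

section \<open>Crossing chords of a Jordan curve\<close>

text \<open>Being inside depends only on the component of the complement of \<open>S\<close>, and a
  connected set avoiding \<open>S\<close> stays in one component.\<close>

lemma connected_subset_inside_or_outside:
  assumes "connected T" "T \<inter> S = {}"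
  shows "T \<subseteq> inside S \<or> T \<subseteq> outside S"
proof (cases "T \<inter> inside S = {}")
  case True
  then show ?thesis using assms(2) inside_Un_outside[of S] by blast
next
  case False
  then obtain x where x: "x \<in> T" "x \<in> inside S" by blast
  have "y \<in> inside S" if "y \<in> T" for y
    using that assms x inside_same_component[of S x y]
    by (meson connected_component_def disjoint_eq_subset_Compl)
  then show ?thesis by blast
qed

text \<open>\<open>C\<close> cuts the inside of \<open>C1 \<union> C2\<close> into the regions
  bounded by \<open>C1 \<union> C\<close> and by \<open>C2 \<union> C\<close>. Each end of
  \<open>D\<close> lies off one of these two curves, and this keeps \<open>D\<close> out of the
  corresponding region; since \<open>D\<close> also misses \<open>C\<close>, no room is left for
  it.\<close>

lemma crossing_arcs_not_inside:
  assumes C1: "arc_between C1 a b" and C2: "arc_between C2 a b" and C12: "C1 \<inter> C2 = {a, b}"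
    and C: "arc_between C a b" "C \<inter> (C1 \<union> C2) = {a, b}"
    and D: "arc_between D x y" "D \<inter> (C1 \<union> C2) = {x, y}"
    and x: "x \<in> C1 - {a, b}" and y: "y \<in> C2 - {a, b}" and CD: "C \<inter> D = {}"
    and inC: "C - {a, b} \<subseteq> inside (C1 \<union> C2)" and inD: "D - {x, y} \<subseteq> inside (C1 \<union> C2)"
  shows False
proof -
  obtain c1 c2 c where c:
      "arc c1" "path_image c1 = C1" "pathstart c1 = a" "pathfinish c1 = b"
      "arc c2" "path_image c2 = C2" "pathstart c2 = a" "pathfinish c2 = b"
      "arc c" "path_image c = C" "pathstart c = a" "pathfinish c = b"
    using C1 C2 C(1) unfolding arc_between_def by blast
  have i: "C1 \<inter> C = {a, b}" "C2 \<inter> C = {a, b}"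
    using C(2) arc_between_ends[OF C1] arc_between_ends[OF C2] by blast+
  \<comment> \<open>The theta curve theorem asks for a point of the dividing arc in the
    inside.\<close>
  have "C \<inter> inside (C1 \<union> C2) \<noteq> {}"
    using inC arc_between_endless_nonempty[OF C(1)] by blast
  then have split: "inside (C1 \<union> C) \<union> inside (C2 \<union> C) \<union> (C - {a, b}) = inside (C1 \<union> C2)"
    using split_inside_simple_closed_curve[of c1 a b c2 c] c C12 i arc_between_ends(1)[OF C1]
    by (metis arc_imp_simple_path)
  \<comment> \<open>Here \<open>s\<close> is the end of \<open>D\<close> on \<open>C'\<close> and
    \<open>t\<close> is the other end. As a point of \<open>C1 \<union> C2\<close>, \<open>t\<close>
    is not inside that curve, hence not in the smaller region; \<open>D - {s}\<close> is connected,
    contains \<open>t\<close> and avoids \<open>C' \<union> C\<close>, so all of it is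
    outside.\<close>
  have *: "(D - {x, y}) \<inter> inside (C' \<union> C) = {}"
    if "arc_between D s t" "{s, t} = {x, y}" "t \<notin> C'" "C' \<subseteq> C1 \<union> C2" "s \<in> C'"
      "inside (C' \<union> C) \<subseteq> inside (C1 \<union> C2)" for s t C'
  proof -
    have "(D - {s}) \<inter> (C' \<union> C) = {}"
      using that D(2) CD by blast
    then have "D - {s} \<subseteq> inside (C' \<union> C) \<or> D - {s} \<subseteq> outside (C' \<union> C)"
      using connected_subset_inside_or_outside arc_between_connected_half_open that(1) by blast
    moreover have "t \<in> D - {s}"
      using arc_between_ends[OF that(1)] by blast
    moreover have "t \<notin> inside (C1 \<union> C2)"
      using that(2) D(2) inside_no_overlap[of "C1 \<union> C2"] by blast
    ultimately have "D - {s} \<subseteq> outside (C' \<union> C)"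
      using that(6) by blast
    then show ?thesis
      using that(2) inside_Int_outside[of "C' \<union> C"] by blast
  qed
  have "x \<notin> C2" "y \<notin> C1" using x y C12 by blast+
  then have "(D - {x, y}) \<inter> inside (C1 \<union> C) = {}" "(D - {x, y}) \<inter> inside (C2 \<union> C) = {}"
    using *[of x y C1] *[of y x C2] D(1) arc_between_sym[OF D(1)] x y split by blast+
  then have "D - {x, y} = {}"
    using inD split CD by blast
  then show False
    using arc_between_endless_nonempty[OF D(1)] by blast
qed

text \<open>The image of the outside, completed by a disc around 0 that stands for a neighbourhood
  of infinity, is an open bounded set \<open>V\<close>. The image \<open>U\<close> of the rest of
  the inside is open and disjoint from it, and together they cover the complement of the image of
  \<open>J\<close>. So the component of an image point of the outside stays in \<open>V\<close> and
  is bounded.\<close>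

lemma inversion_outside_subset_inside:
  fixes z :: complex
  assumes J: "compact J" and z: "z \<in> inside J"
  shows "(\<lambda>t. inverse (t - z)) ` outside J \<subseteq> inside ((\<lambda>t. inverse (t - z)) ` J)"
proof
  let ?f = "\<lambda>t. inverse (t - z)" and ?g = "\<lambda>w. inverse w + z"
  \<comment> \<open>This covers \<open>w = 0\<close> as well: \<open>inverse 0 = 0\<close> gives
    \<open>?f z = 0\<close> and \<open>?g 0 = z\<close>.\<close>
  have img: "w \<in> ?f ` A \<longleftrightarrow> ?g w \<in> A" for w A
    by (metis (no_types, lifting) add_diff_cancel diff_add_cancel image_iff inverse_inverse_eq)
  have cont: "continuous_on (- {0}) ?g"
    by (intro continuous_intros) auto
  have op: "open {w. w \<noteq> 0 \<and> ?g w \<in> A}" if "open A" for A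
  proof -
    have "{w. w \<noteq> 0 \<and> ?g w \<in> A} = - {0} \<inter> ?g -` A" by auto
    then show ?thesis
      using continuous_open_preimage[OF cont open_Compl[OF closed_singleton] that] by metis
  qed
  obtain B where B: "B > 0" "\<And>t. t \<in> J \<union> inside J \<Longrightarrow> norm (t - z) \<le> B"
  proof -
    have "bounded (J \<union> inside J)"
      using bounded_inside[OF compact_imp_bounded[OF J]] compact_imp_bounded[OF J] by simp
    then have "bounded ((\<lambda>t. t - z) ` (J \<union> inside J))"
      using bounded_translation_minus by blast
    then show ?thesis
      unfolding bounded_pos using that by auto
  qed
  obtain e where e: "e > 0" "ball z e \<subseteq> inside J"
    using open_inside[OF compact_imp_closed[OF J]] z open_contains_ball by blast
  define U where "U = {w. w \<noteq> 0 \<and> ?g w \<in> inside J}"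
  \<comment> \<open>The point 0 needs separate treatment, since \<open>?g 0\<close> is
    \<open>z\<close> and not infinity. Nonzero points of the disc are sent by \<open>?g\<close>
    further than \<open>B\<close> from \<open>z\<close>, hence to the outside.\<close>
  define V where "V = ball 0 (inverse B) \<union> {w. w \<noteq> 0 \<and> ?g w \<in> outside J}"
  have opUV: "open U" "open V"
    using op open_inside open_outside compact_imp_closed[OF J] unfolding U_def V_def by auto
  have small: "?g w \<in> outside J" if "w \<in> ball 0 (inverse B)" "w \<noteq> 0" for w
  proof -
    have "norm w < inverse B" using that(1) by simp
    then have "norm (?g w - z) > B"
      using less_imp_inverse_less[of "norm w" "inverse B"] that(2) by (simp add: norm_inverse)
    then have "?g w \<notin> J \<union> inside J"
      using B(2) by force
    then show ?thesis
      using inside_Un_outside[of J] by blast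
  qed
  have UV: "U \<inter> V = {}"
    using small inside_Int_outside[of J] B(1) unfolding U_def V_def by blast
  have cov: "- (?f ` J) \<subseteq> U \<union> V"
  proof
    fix w assume "w \<in> - (?f ` J)"
    then have "?g w \<in> inside J \<or> ?g w \<in> outside J"
      using img[of w J] inside_Un_outside[of J] by blast
    then show "w \<in> U \<union> V"
      unfolding U_def V_def using B(1) by (cases "w = 0") auto
  qed
  \<comment> \<open>Points of the outside keep distance at least \<open>e\<close> from
    \<open>z\<close>, so their images have norm at most \<open>inverse e\<close>.\<close>
  have "bounded V"
  proof -
    have "norm w \<le> inverse e" if "w \<noteq> 0" "?g w \<in> outside J" for w
    proof -
      have "?g w \<notin> ball z e" using that(2) e(2) inside_Int_outside[of J] by blast
      then have "e \<le> inverse (norm w)" by (simp add: dist_norm norm_inverse)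
      then show ?thesis using e(1) that(1)
        by (metis inverse_inverse_eq le_imp_inverse_le)
    qed
    then have "V \<subseteq> ball 0 (inverse B) \<union> cball 0 (inverse e)"
      unfolding V_def by auto
    then show ?thesis
      by (meson bounded_Un bounded_ball bounded_cball bounded_subset)
  qed
  fix w assume w: "w \<in> ?f ` outside J"
  have gw: "?g w \<in> outside J" using w img by blast
  moreover have "z \<notin> outside J" using z inside_Int_outside[of J] by blast
  ultimately have w0: "w \<noteq> 0" by auto
  then have "w \<in> V" using gw unfolding V_def by blast
  have nJ: "w \<notin> ?f ` J" using gw img[of w J] outside_no_overlap[of J] by blast
  let ?K = "connected_component_set (- (?f ` J)) w"
  have "?K \<subseteq> U \<union> V"
    using cov connected_component_subset by blast
  moreover have "w \<in> ?K"
    using nJ by (simp add: connected_component_refl)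
  ultimately have "U \<inter> ?K = {}"
    using connected_connected_component[of "- (?f ` J)" w] opUV UV \<open>w \<in> V\<close>
    unfolding connected_def by blast
  then have "?K \<subseteq> V" using \<open>?K \<subseteq> U \<union> V\<close> by blast
  then have "bounded ?K" using \<open>bounded V\<close> bounded_subset by blast
  then show "w \<in> inside (?f ` J)"
    unfolding inside_def using nJ by simp
qed

text \<open>Inversion at a point \<open>z\<close> inside the curve maps all four arcs to arcs with
  the same incidences and moves the outside into the inside of the new curve, where the previous
  case applies.\<close>

lemma crossing_arcs_not_outside:
  assumes C1: "arc_between C1 a b" and C2: "arc_between C2 a b" and C12: "C1 \<inter> C2 = {a, b}"
    and C: "arc_between C a b" "C \<inter> (C1 \<union> C2) = {a, b}"
    and D: "arc_between D x y" "D \<inter> (C1 \<union> C2) = {x, y}"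
    and x: "x \<in> C1 - {a, b}" and y: "y \<in> C2 - {a, b}" and CD: "C \<inter> D = {}"
    and outC: "C - {a, b} \<subseteq> outside (C1 \<union> C2)" and outD: "D - {x, y} \<subseteq> outside (C1 \<union> C2)"
  shows False
proof -
  obtain c1 c2 where c:
      "arc c1" "path_image c1 = C1" "pathstart c1 = a" "pathfinish c1 = b"
      "arc c2" "path_image c2 = C2" "pathstart c2 = b" "pathfinish c2 = a"
    using C1 arc_between_sym[OF C2] unfolding arc_between_def by blast
  \<comment> \<open>\<open>c2\<close> was taken from \<open>b\<close> to \<open>a\<close>, so the
    join is a closed curve and the Jordan curve theorem provides the centre
    \<open>z\<close>.\<close>
  have "simple_path (c1 +++ c2)"
    using c C12 by (intro simple_path_join_loop) auto
  then have "inside (C1 \<union> C2) \<noteq> {}"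
    using Jordan_inside_outside[of "c1 +++ c2"] c by (simp add: path_image_join)
  then obtain z where z: "z \<in> inside (C1 \<union> C2)" by blast
  define f where "f = (\<lambda>t. inverse (t - z))"
  \<comment> \<open>With \<open>inverse 0 = 0\<close> the map is injective on the whole plane,
    including \<open>z\<close>, so it commutes with intersections and differences.\<close>
  have inj: "inj f" unfolding f_def inj_def by simp
  have zJ: "z \<notin> C1 \<union> C2" and zout: "z \<notin> outside (C1 \<union> C2)"
    using z inside_no_overlap[of "C1 \<union> C2"] inside_Int_outside[of "C1 \<union> C2"] by blast+
  have "{a, b, x, y} \<subseteq> C1 \<union> C2" using C12 x y by blast
  then have avoid: "z \<notin> C1" "z \<notin> C2" "z \<notin> C" "z \<notin> D"
    using zJ zout outC outD by auto
  have arc: "arc_between (f ` S) (f s) (f t)" if "arc_between S s t" "z \<notin> S" for S s t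
    using that(1)
  proof (rule arc_between_image)
    show "continuous_on S f"
      unfolding f_def using that(2) by (intro continuous_intros) auto
    show "inj_on f S" using inj inj_on_subset by blast
  qed
  have J: "compact (C1 \<union> C2)" using C1 C2 arc_between_compact by blast
  have inv: "f ` outside (C1 \<union> C2) \<subseteq> inside (f ` C1 \<union> f ` C2)"
    using inversion_outside_subset_inside[OF J z] unfolding f_def image_Un .
  have img: "f ` S \<inter> f ` T = f ` (S \<inter> T)" "f ` S - f ` T = f ` (S - T)" for S T
    using inj by (simp_all add: image_Int image_set_diff)
  show False
  proof (rule crossing_arcs_not_inside[of "f ` C1" "f a" "f b" "f ` C2" "f ` C" "f ` D" "f x" "f y"])
    show "f ` C1 \<inter> f ` C2 = {f a, f b}" using img C12 by simp
    show "f ` C \<inter> (f ` C1 \<union> f ` C2) = {f a, f b}"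
      using img(1)[of C "C1 \<union> C2"] C(2) by (simp add: image_Un)
    show "f ` D \<inter> (f ` C1 \<union> f ` C2) = {f x, f y}"
      using img(1)[of D "C1 \<union> C2"] D(2) by (simp add: image_Un)
    show "f x \<in> f ` C1 - {f a, f b}" "f y \<in> f ` C2 - {f a, f b}"
      using x y inj by (auto simp: inj_def)
    show "f ` C \<inter> f ` D = {}" using img CD by simp
    show "f ` C - {f a, f b} \<subseteq> inside (f ` C1 \<union> f ` C2)"
      using img(2)[of C "{a, b}"] outC inv by auto
    show "f ` D - {f x, f y} \<subseteq> inside (f ` C1 \<union> f ` C2)"
      using img(2)[of D "{x, y}"] outD inv by auto
  qed (use arc[OF C1] arc[OF C2] arc[OF C(1)] arc[OF D(1)] avoid in simp_all)
qed

section \<open>Paths in a graph and their drawings\<close>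

text \<open>The list is read as a walk; a cycle is written by repeating its first vertex at the
  end.\<close>

fun path_edges :: "'a list \<Rightarrow> 'a set set" where
  "path_edges (x # y # zs) = insert {x, y} (path_edges (y # zs))"
| "path_edges _ = {}"

lemma path_edges_subset: "e \<in> path_edges xs \<Longrightarrow> e \<subseteq> set xs"
  by (induction xs rule: path_edges.induct) auto

lemma Union_path_edges: "xs \<noteq> [] \<Longrightarrow> \<Union> (path_edges (x # xs)) = set (x # xs)"
proof (induction xs arbitrary: x)
  case (Cons y ys)
  then show ?case by (cases ys) auto
qed simp

text \<open>Only the first edge contains \<open>a\<close>, and it ends in an inner vertex. This
  separates a chord from the edges of the path that it spans.\<close>

lemma ends_notin_path_edges:
  assumes "distinct (a # ps @ [b])" "ps \<noteq> []"
  shows "{a, b} \<notin> path_edges (a # ps @ [b])"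
proof -
  obtain s ss where ps: "ps = s # ss" using assms(2) by (cases ps) auto
  have "{a, b} \<noteq> {a, s}" using assms(1) ps by (auto simp: doubleton_eq_iff)
  moreover have "{a, b} \<notin> path_edges (ps @ [b])"
    using path_edges_subset[of "{a, b}" "ps @ [b]"] assms(1) by auto
  ultimately show ?thesis using ps by simp
qed

text \<open>Single edges are drawn as singletons \<open>{e}\<close>, so that edges, paths and cycles
  share one intersection lemma.\<close>

definition drawn :: "('a set \<Rightarrow> real \<Rightarrow> complex) \<Rightarrow> 'a set set \<Rightarrow> complex set" where
  "drawn c E = (\<Union>e\<in>E. path_image (c e))"

lemma drawn_Un: "drawn c (E \<union> F) = drawn c E \<union> drawn c F"
  unfolding drawn_def by blast

lemma plane_drawing_inj: "plane_drawing G p c \<Longrightarrow> inj_on p (verts G)"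
  unfolding plane_drawing_def by (elim conjE)

lemma plane_drawing_edge:
  assumes "plane_drawing G p c" "e \<in> edges G"
  shows "arc (c e)" "{pathstart (c e), pathfinish (c e)} = p ` e" "p ` e \<subseteq> path_image (c e)"
proof -
  have "\<forall>e \<in> edges G. arc (c e) \<and> {pathstart (c e), pathfinish (c e)} = p ` e
        \<and> path_image (c e) \<inter> p ` verts G = p ` e"
    using assms(1) unfolding plane_drawing_def by (elim conjE)
  from bspec[OF this assms(2)]
  show "arc (c e)" "{pathstart (c e), pathfinish (c e)} = p ` e" "p ` e \<subseteq> path_image (c e)"
    by (metis, metis, metis Int_lower1)
qed

lemma plane_drawing_Int:
  assumes "plane_drawing G p c" "e \<in> edges G" "f \<in> edges G" "e \<noteq> f"
  shows "path_image (c e) \<inter> path_image (c f) \<subseteq> p ` (e \<inter> f)"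
proof -
  have "\<forall>e \<in> edges G. \<forall>f \<in> edges G. e \<noteq> f \<longrightarrow>
        path_image (c e) \<inter> path_image (c f) \<subseteq> p ` (e \<inter> f)"
    using assms(1) unfolding plane_drawing_def by (elim conjE)
  then show ?thesis using assms(2-4) by simp
qed

text \<open>Disjointness of \<open>E\<close> and \<open>F\<close> makes every pair of edges
  distinct, so each pair of curves meets only in common vertices.\<close>

lemma drawn_Int:
  assumes "plane_drawing G p c" "E \<subseteq> edges G" "F \<subseteq> edges G" "E \<inter> F = {}"
  shows "drawn c E \<inter> drawn c F \<subseteq> p ` (\<Union>E \<inter> \<Union>F)"
proof
  fix z assume "z \<in> drawn c E \<inter> drawn c F"
  then obtain e f where ef: "e \<in> E" "f \<in> F" "z \<in> path_image (c e) \<inter> path_image (c f)"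
    unfolding drawn_def by blast
  have "e \<in> edges G" "f \<in> edges G" "e \<noteq> f" using assms(2-4) ef(1,2) by blast+
  from plane_drawing_Int[OF assms(1) this] have "z \<in> p ` (e \<inter> f)"
    using ef(3) by (rule subsetD)
  then show "z \<in> p ` (\<Union>E \<inter> \<Union>F)" using ef by blast
qed

lemma vertex_in_drawn:
  assumes "plane_drawing G p c" "E \<subseteq> edges G" "x \<in> \<Union>E"
  shows "p x \<in> drawn c E"
proof -
  obtain e where e: "e \<in> E" "x \<in> e" using assms(3) by blast
  then have "p ` e \<subseteq> path_image (c e)"
    using plane_drawing_edge(3)[OF assms(1)] assms(2) by blast
  then show ?thesis
    using e unfolding drawn_def by blast
qed

lemma arc_between_drawn_edge:
  assumes "plane_drawing G p c" "{x, y} \<in> edges G"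
  shows "arc_between (drawn c {{x, y}}) (p x) (p y)"
proof -
  have "arc_between (drawn c {{x, y}}) (pathstart (c {x, y})) (pathfinish (c {x, y}))"
    using plane_drawing_edge(1)[OF assms] unfolding arc_between_def drawn_def by auto
  moreover have "{pathstart (c {x, y}), pathfinish (c {x, y})} = {p x, p y}"
    using plane_drawing_edge(2)[OF assms] by simp
  \<comment> \<open>A plane drawing leaves the direction of each curve open, hence the two
    cases.\<close>
  ultimately have "arc_between (drawn c {{x, y}}) (p x) (p y) \<or> arc_between (drawn c {{x, y}}) (p y) (p x)"
    unfolding doubleton_eq_iff by metis
  then show ?thesis using arc_between_sym by blast
qed

text \<open>Edges are prepended one at a time: without repeated vertices, the new edge shares only
  the vertex \<open>y\<close> with the rest.\<close>

lemma arc_between_drawn_path: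
  assumes "plane_drawing G p c"
  shows "\<lbrakk>path_edges (x # xs) \<subseteq> edges G; distinct (x # xs); xs \<noteq> []\<rbrakk>
    \<Longrightarrow> arc_between (drawn c (path_edges (x # xs))) (p x) (p (last xs))"
proof (induction xs arbitrary: x)
  case (Cons y ys)
  have xy: "arc_between (drawn c {{x, y}}) (p x) (p y)"
    using arc_between_drawn_edge[OF assms] Cons.prems(1) by simp
  show ?case
  proof (cases "ys = []")
    case True
    then show ?thesis using xy by simp
  next
    case False
    let ?E = "path_edges (y # ys)"
    have "{x, y} \<notin> ?E"
      using path_edges_subset[of "{x, y}" "y # ys"] Cons.prems(2) by auto
    then have "drawn c {{x, y}} \<inter> drawn c ?E \<subseteq> p ` (\<Union>{{x, y}} \<inter> \<Union>?E)"
      using Cons.prems(1) by (intro drawn_Int[OF assms]) auto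
    also have "\<dots> \<subseteq> {p y}"
      using Union_path_edges[OF False, of y] Cons.prems(2) by auto
    finally have "arc_between (drawn c {{x, y}} \<union> drawn c ?E) (p x) (p (last ys))"
      using Cons False by (intro arc_between_join[OF xy]) auto
    then show ?thesis
      using False by (simp add: drawn_Un[symmetric])
  qed
qed simp

section \<open>Chords of a drawn cycle\<close>

definition same_side :: "complex set \<Rightarrow> complex set \<Rightarrow> complex set \<Rightarrow> bool" where
  "same_side J S T \<longleftrightarrow> S \<union> T \<subseteq> inside J \<or> S \<union> T \<subseteq> outside J"

text \<open>The two paths from \<open>a\<close> to \<open>b\<close> form a cycle on which
  \<open>a\<close> and \<open>b\<close> separate \<open>x\<close> from \<open>y\<close>. Drawing
  them yields exactly the configuration excluded on the inside and on the outside.\<close>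

lemma crossing_chords_not_same_side:
  assumes G: "simple_graph G" "plane_drawing G p c"
    and P: "path_edges (a # ps @ [b]) \<subseteq> edges G" "distinct (a # ps @ [b])"
    and Q: "path_edges (a # qs @ [b]) \<subseteq> edges G" "distinct (a # qs @ [b])"
    and PQ: "set ps \<inter> set qs = {}"
    and ab: "{a, b} \<in> edges G" and xy: "{x, y} \<in> edges G" "x \<in> set ps" "y \<in> set qs"
  shows "\<not> same_side (drawn c (path_edges (a # ps @ [b]) \<union> path_edges (a # qs @ [b])))
            (drawn c {{a, b}} - {p a, p b}) (drawn c {{x, y}} - {p x, p y})"
proof -
  let ?P = "path_edges (a # ps @ [b])" and ?Q = "path_edges (a # qs @ [b])"
  have U: "\<Union>?P = set (a # ps @ [b])" "\<Union>?Q = set (a # qs @ [b])"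
    using Union_path_edges[of "ps @ [b]" a] Union_path_edges[of "qs @ [b]" a] by simp_all
  have "ps \<noteq> []" "qs \<noteq> []" using xy by auto
  then have nab: "{a, b} \<notin> ?P" "{a, b} \<notin> ?Q"
    using ends_notin_path_edges[OF P(2)] ends_notin_path_edges[OF Q(2)] by simp_all
  have nxy: "{x, y} \<notin> ?P" "{x, y} \<notin> ?Q"
    using path_edges_subset[of "{x, y}" "a # ps @ [b]"] path_edges_subset[of "{x, y}" "a # qs @ [b]"]
      P(2) Q(2) PQ xy by auto
  \<comment> \<open>A common edge has its vertices in \<open>{a, b}\<close>; having two elements it
    equals \<open>{a, b}\<close>, which is an edge of neither path.\<close>
  have disj: "?P \<inter> ?Q = {}"
  proof (rule ccontr)
    assume "?P \<inter> ?Q \<noteq> {}"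
    then obtain e where e: "e \<in> ?P" "e \<in> ?Q" by blast
    then have "e \<subseteq> {a, b}"
      using path_edges_subset[OF e(1)] path_edges_subset[OF e(2)] PQ by auto
    moreover have "card e = 2" using e P(1) G(1) unfolding simple_graph_def by blast
    moreover have "card {a, b} = 2" using P(2) by auto
    ultimately have "e = {a, b}" by (intro card_subset_eq) auto
    then show False using e nab by blast
  qed
  have "\<Union>?P \<subseteq> verts G" "\<Union>?Q \<subseteq> verts G"
    using P(1) Q(1) G(1) unfolding simple_graph_def by blast+
  then have in_verts: "set ps \<union> set qs \<union> {a, b} \<subseteq> verts G"
    unfolding U by simp
  have inj: "p s = p t \<longleftrightarrow> s = t" if "s \<in> set ps \<union> set qs \<union> {a, b}" "t \<in> set ps \<union> set qs \<union> {a, b}" for s t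
    using plane_drawing_inj[OF G(2)] that in_verts by (meson inj_on_eq_iff subsetD)
  have ne: "x \<noteq> a" "x \<noteq> b" "y \<noteq> a" "y \<noteq> b" using P(2) Q(2) xy by auto
  let ?C1 = "drawn c ?P" and ?C2 = "drawn c ?Q" and ?C = "drawn c {{a, b}}" and ?D = "drawn c {{x, y}}"
  have "arc_between ?C1 (p a) (p (last (ps @ [b])))" "arc_between ?C2 (p a) (p (last (qs @ [b])))"
    using arc_between_drawn_path[OF G(2)] P Q by blast+
  then have C12: "arc_between ?C1 (p a) (p b)" "arc_between ?C2 (p a) (p b)" by simp_all
  have CD: "arc_between ?C (p a) (p b)" "arc_between ?D (p x) (p y)"
    using arc_between_drawn_edge[OF G(2)] ab xy by blast+
  have "\<Union>?P \<inter> \<Union>?Q = {a, b}" unfolding U using PQ by auto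
  then have "?C1 \<inter> ?C2 \<subseteq> {p a, p b}"
    using drawn_Int[OF G(2) P(1) Q(1) disj] by simp
  then have i12: "?C1 \<inter> ?C2 = {p a, p b}"
    using arc_between_ends(2,3)[OF C12(1)] arc_between_ends(2,3)[OF C12(2)]
    by (intro equalityI) simp_all
  have chord: "drawn c {{s, t}} \<inter> drawn c K \<subseteq> {p s, p t}"
    if "{s, t} \<in> edges G" "K \<subseteq> edges G" "{s, t} \<notin> K" for s t K
    using drawn_Int[OF G(2), of "{{s, t}}" K] that by auto
  have iC: "?C \<inter> (?C1 \<union> ?C2) = {p a, p b}"
    using chord[OF ab P(1) nab(1)] chord[OF ab Q(1) nab(2)]
      arc_between_ends(2,3)[OF C12(1)] arc_between_ends(2,3)[OF CD(1)]
    by (intro equalityI) (simp_all add: Int_Un_distrib)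
  have px: "p x \<in> ?C1" "p y \<in> ?C2"
    using vertex_in_drawn[OF G(2) P(1), of x] vertex_in_drawn[OF G(2) Q(1), of y] xy(2,3)
    unfolding U by simp_all
  have iD: "?D \<inter> (?C1 \<union> ?C2) = {p x, p y}"
    using chord[OF xy(1) P(1) nxy(1)] chord[OF xy(1) Q(1) nxy(2)]
      px arc_between_ends(2,3)[OF CD(2)]
    by (intro equalityI) (simp_all add: Int_Un_distrib)
  have x1: "p x \<in> ?C1 - {p a, p b}" and y2: "p y \<in> ?C2 - {p a, p b}"
    using px inj xy ne by auto
  have "?C \<inter> ?D \<subseteq> p ` (\<Union>{{a, b}} \<inter> \<Union>{{x, y}})"
    using ab xy ne by (intro drawn_Int[OF G(2)]) (auto simp: doubleton_eq_iff)
  then have iCD: "?C \<inter> ?D = {}" using ne by auto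
  show ?thesis
    unfolding same_side_def drawn_Un Un_subset_iff
    using crossing_arcs_not_inside[OF C12 i12 CD(1) iC CD(2) iD x1 y2 iCD]
      crossing_arcs_not_outside[OF C12 i12 CD(1) iC CD(2) iD x1 y2 iCD] by fast
qed

lemma chord_inside_or_outside:
  assumes G: "plane_drawing G p c" and K: "K \<subseteq> edges G" and e: "{x, y} \<in> edges G - K"
  shows "drawn c {{x, y}} - {p x, p y} \<subseteq> inside (drawn c K)
    \<or> drawn c {{x, y}} - {p x, p y} \<subseteq> outside (drawn c K)"
proof (rule connected_subset_inside_or_outside)
  show "connected (drawn c {{x, y}} - {p x, p y})"
    using arc_between_drawn_edge[OF G] e arc_between_connected_endless by blast
  have "drawn c {{x, y}} \<inter> drawn c K \<subseteq> p ` (\<Union>{{x, y}} \<inter> \<Union>K)"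
    using e K by (intro drawn_Int[OF G]) auto
  then show "(drawn c {{x, y}} - {p x, p y}) \<inter> drawn c K = {}" by auto
qed

text \<open>The diagonals cross pairwise, but the cycle has only two sides. The configuration is a
  subdivided \<open>K_{3,3}\<close>: suppressing \<open>v3\<close> and \<open>v7\<close> leaves a
  hexagon with its three long diagonals.\<close>

lemma octagon_with_three_diagonals_not_planar:
  assumes G: "simple_graph G"
    and dist: "distinct [v0, v1, v2, v3, v4, v5, v6, v7]"
    and cyc: "path_edges [v0, v1, v2, v3, v4, v5, v6, v7, v0] \<subseteq> edges G"
    and diag: "{v0, v4} \<in> edges G" "{v1, v5} \<in> edges G" "{v2, v6} \<in> edges G"
  shows "\<not> planar G"
proof
  assume "planar G"
  then obtain p c where pc: "plane_drawing G p c" unfolding planar_def by blast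
  let ?K = "path_edges [v0, v1, v2, v3, v4, v5, v6, v7, v0]"
  let ?S = "\<lambda>x y. drawn c {{x, y}} - {p x, p y}"
  \<comment> \<open>The cycle is split at \<open>v0\<close>, \<open>v4\<close> for the two pairs
    containing that diagonal and at \<open>v1\<close>, \<open>v5\<close> for the remaining pair. The
    second path of each splitting runs backwards.\<close>
  have K1: "path_edges (v0 # [v1, v2, v3] @ [v4]) \<union> path_edges (v0 # [v7, v6, v5] @ [v4]) = ?K"
    and K2: "path_edges (v1 # [v2, v3, v4] @ [v5]) \<union> path_edges (v1 # [v0, v7, v6] @ [v5]) = ?K"
    by (simp_all add: insert_commute)
  have sub1: "path_edges (v0 # [v1, v2, v3] @ [v4]) \<subseteq> edges G"
      "path_edges (v0 # [v7, v6, v5] @ [v4]) \<subseteq> edges G"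
    using cyc unfolding K1[symmetric] Un_subset_iff by (rule conjunct1, rule conjunct2)
  have sub2: "path_edges (v1 # [v2, v3, v4] @ [v5]) \<subseteq> edges G"
      "path_edges (v1 # [v0, v7, v6] @ [v5]) \<subseteq> edges G"
    using cyc unfolding K2[symmetric] Un_subset_iff by (rule conjunct1, rule conjunct2)
  note crossing = crossing_chords_not_same_side[OF G pc]
  have "\<not> same_side (drawn c ?K) (?S v0 v4) (?S v1 v5)"
    by (rule crossing[OF sub1(1) _ sub1(2), unfolded K1]) (use dist diag in auto)
  moreover have "\<not> same_side (drawn c ?K) (?S v0 v4) (?S v2 v6)"
    by (rule crossing[OF sub1(1) _ sub1(2), unfolded K1]) (use dist diag in auto)
  moreover have "\<not> same_side (drawn c ?K) (?S v1 v5) (?S v2 v6)"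
    by (rule crossing[OF sub2(1) _ sub2(2), unfolded K2]) (use dist diag in auto)
  moreover have "{v0, v4} \<notin> ?K" "{v1, v5} \<notin> ?K" "{v2, v6} \<notin> ?K"
    using dist by (auto simp: doubleton_eq_iff)
  moreover have "?S x y \<subseteq> inside (drawn c ?K) \<or> ?S x y \<subseteq> outside (drawn c ?K)"
    if "{x, y} \<in> edges G" "{x, y} \<notin> ?K" for x y
    using chord_inside_or_outside[OF pc cyc] that by blast
  ultimately show False
    using diag unfolding same_side_def Un_subset_iff by metis
qed

section \<open>Products of rings and their regular graphs\<close>

text \<open>Prepending a coordinate is a ring homomorphism from the binary product of
  \<open>R\<close> and \<open>RDirProd_list Rs\<close>.\<close>

lemma RDirProd_list_mult_Cons:
  assumes "a \<in> carrier R" "b \<in> carrier R"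
    and "as \<in> carrier (RDirProd_list Rs)" "bs \<in> carrier (RDirProd_list Rs)"
  shows "(a # as) \<otimes>\<^bsub>RDirProd_list (R # Rs)\<^esub> (b # bs) =
    (a \<otimes>\<^bsub>R\<^esub> b) # (as \<otimes>\<^bsub>RDirProd_list Rs\<^esub> bs)"
  using ring_hom_mult[OF RDirProd_list_hom1, of "(a, as)" R Rs "(b, bs)"] assms
  by (simp add: RDirProd_carrier) (simp add: RDirProd_def DirProd_def monoid.defs)

lemma RDirProd_list_mult_nth:
  assumes "as \<in> carrier (RDirProd_list Rs)" "bs \<in> carrier (RDirProd_list Rs)" "k < length Rs"
  shows "(as \<otimes>\<^bsub>RDirProd_list Rs\<^esub> bs) ! k = as ! k \<otimes>\<^bsub>Rs ! k\<^esub> bs ! k"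
  using assms
proof (induction Rs arbitrary: as bs k)
  case (Cons R Rs)
  then obtain a as' b bs' where "as = a # as'" "bs = b # bs'"
    "a \<in> carrier R" "b \<in> carrier R" "as' \<in> carrier (RDirProd_list Rs)" "bs' \<in> carrier (RDirProd_list Rs)"
    unfolding RDirProd_list_carrier by auto
  then show ?case
    using Cons by (cases k) (simp_all add: RDirProd_list_mult_Cons)
qed simp

lemma RDirProd_list_zero_eq_map: "\<zero>\<^bsub>RDirProd_list Rs\<^esub> = map zero Rs"
  unfolding RDirProd_list_zero by (induction Rs) auto

text \<open>The identity is checked coordinatewise, so it may hold for different reasons in
  different coordinates: inverse units in one, zero in another.\<close>

lemma RDirProd_list_inner_inverse:
  assumes rings: "\<And>k. k < length Rs \<Longrightarrow> ring (Rs ! k)"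
    and carr: "as \<in> carrier (RDirProd_list Rs)" "bs \<in> carrier (RDirProd_list Rs)"
    and eq: "\<And>k. k < length Rs \<Longrightarrow> bs ! k \<otimes>\<^bsub>Rs ! k\<^esub> as ! k \<otimes>\<^bsub>Rs ! k\<^esub> bs ! k = bs ! k"
  shows "bs \<otimes>\<^bsub>RDirProd_list Rs\<^esub> as \<otimes>\<^bsub>RDirProd_list Rs\<^esub> bs = bs"
proof -
  interpret ring "RDirProd_list Rs" using RDirProd_list_is_ring[OF rings] .
  show ?thesis
  proof (rule nth_equalityI)
    show "length (bs \<otimes>\<^bsub>RDirProd_list Rs\<^esub> as \<otimes>\<^bsub>RDirProd_list Rs\<^esub> bs) = length bs"
      using carr RDirProd_list_carrier_mem(1) by (metis m_closed)
    fix k assume "k < length (bs \<otimes>\<^bsub>RDirProd_list Rs\<^esub> as \<otimes>\<^bsub>RDirProd_list Rs\<^esub> bs)"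
    then have "k < length Rs"
      using carr RDirProd_list_carrier_mem(1) by (metis m_closed)
    then show "(bs \<otimes>\<^bsub>RDirProd_list Rs\<^esub> as \<otimes>\<^bsub>RDirProd_list Rs\<^esub> bs) ! k = bs ! k"
      using carr eq by (simp add: RDirProd_list_mult_nth)
  qed
qed

text \<open>\<open>R\<close> is given only up to isomorphism. Adjacency is computed in the product
  and carried over by \<open>g\<close>, which preserves products, zero and distinctness.\<close>

lemma Reg_graph_edge_ring_iso:
  assumes "ring P" "ring R" "g \<in> ring_iso P R"
    and "a \<in> carrier P - {\<zero>\<^bsub>P\<^esub>}" "b \<in> carrier P - {\<zero>\<^bsub>P\<^esub>}" "a \<noteq> b" "b \<otimes>\<^bsub>P\<^esub> a \<otimes>\<^bsub>P\<^esub> b = b"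
  shows "{g a, g b} \<in> edges (Reg_graph R)"
proof -
  interpret P: ring P by fact
  have g: "g \<in> ring_hom P R" "inj_on g (carrier P)"
    using assms(3) unfolding ring_iso_def bij_betw_def by auto
  have "g \<zero>\<^bsub>P\<^esub> = \<zero>\<^bsub>R\<^esub>" using ring_hom_zero[OF g(1) assms(1,2)] .
  then have "g a \<noteq> \<zero>\<^bsub>R\<^esub>" "g b \<noteq> \<zero>\<^bsub>R\<^esub>" "g a \<noteq> g b"
    using assms(4-6) g(2) P.zero_closed by (metis DiffD1 DiffD2 inj_on_eq_iff singletonI)+
  moreover have "g b \<otimes>\<^bsub>R\<^esub> g a \<otimes>\<^bsub>R\<^esub> g b = g b"
    using assms(4,5,7) ring_hom_mult[OF g(1)] by (metis DiffD1 P.m_closed)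
  ultimately show ?thesis
    using assms(4,5) ring_hom_closed[OF g(1)] unfolding Reg_graph_def by auto
qed

theorem lemma3:
  fixes R :: "('a, 'm) ring_scheme" and Fs :: "('b ring) list" and n :: nat
  assumes "n \<ge> 2" and "length Fs = n"
    and "\<And>k. k < n \<Longrightarrow> field (Fs ! k) \<and> finite (carrier (Fs ! k))"
    and "cring R" and "R \<simeq> RDirProd_list Fs"
    and "\<exists>i j. i < j \<and> j < n \<and> card (U2 (Fs ! i)) > 0 \<and> card (U2 (Fs ! j)) > 0"
  shows "\<not> planar (Reg_graph R)"
proof -
  let ?P = "RDirProd_list Fs"
  have rings: "ring (Fs ! k)" if "k < length Fs" for k
    using assms(2,3) that by (simp add: field.is_ring)
  have P: "ring ?P" using RDirProd_list_is_ring[OF rings] .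
  have R: "ring R" using assms(4) cring.axioms(1) by blast
  obtain h where "h \<in> ring_iso R ?P" using assms(5) unfolding is_ring_iso_def by blast
  then obtain g where g: "g \<in> ring_iso ?P R" using ring_iso_set_sym[OF R] by blast
  obtain i j where ij: "i < j" "j < n" "card (U2 (Fs ! i)) > 0" "card (U2 (Fs ! j)) > 0"
    using assms(6) by blast
  \<comment> \<open>The witness \<open>u'\<close> is the inverse of \<open>u\<close>, distinct from
    \<open>u\<close> by the definition of \<open>U2\<close>. From here on only the two regularity
    identities matter.\<close>
  have unit: "\<exists>u u'. {u, u'} \<subseteq> carrier F - {\<zero>\<^bsub>F\<^esub>} \<and> u \<noteq> u' \<and>
      u \<otimes>\<^bsub>F\<^esub> u' \<otimes>\<^bsub>F\<^esub> u = u \<and> u' \<otimes>\<^bsub>F\<^esub> u \<otimes>\<^bsub>F\<^esub> u' = u'"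
    if F: "field F" and pos: "card (U2 F) > 0" for F :: "'b ring"
  proof -
    interpret field F by fact
    obtain u where "u \<in> U2 F"
      using pos by (metis card.empty equals0I less_irrefl)
    then have u: "u \<in> Units F" "inv\<^bsub>F\<^esub> u \<noteq> u" unfolding U2_def by auto
    then have "{u, inv\<^bsub>F\<^esub> u} \<subseteq> carrier F - {\<zero>\<^bsub>F\<^esub>}"
      using Units_inv_Units[OF u(1)] field_Units by auto
    then show ?thesis
      using u by (intro exI[of _ u] exI[of _ "inv\<^bsub>F\<^esub> u"]) auto
  qed
  obtain u u' where u: "{u, u'} \<subseteq> carrier (Fs ! i) - {\<zero>\<^bsub>Fs ! i\<^esub>}" "u \<noteq> u'"
      "u \<otimes>\<^bsub>Fs ! i\<^esub> u' \<otimes>\<^bsub>Fs ! i\<^esub> u = u" "u' \<otimes>\<^bsub>Fs ! i\<^esub> u \<otimes>\<^bsub>Fs ! i\<^esub> u' = u'"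
    using unit[of "Fs ! i"] assms(3)[of i] ij by auto
  obtain v v' where v: "{v, v'} \<subseteq> carrier (Fs ! j) - {\<zero>\<^bsub>Fs ! j\<^esub>}" "v \<noteq> v'"
      "v \<otimes>\<^bsub>Fs ! j\<^esub> v' \<otimes>\<^bsub>Fs ! j\<^esub> v = v" "v' \<otimes>\<^bsub>Fs ! j\<^esub> v \<otimes>\<^bsub>Fs ! j\<^esub> v' = v'"
    using unit[of "Fs ! j"] assms(3)[of j] ij by auto
  let ?zi = "\<zero>\<^bsub>Fs ! i\<^esub>" and ?zj = "\<zero>\<^bsub>Fs ! j\<^esub>"
  \<comment> \<open>All coordinates other than \<open>i\<close> and \<open>j\<close> are zero, where
    the regularity identity is trivial.\<close>
  define w where "w s t = (map zero Fs)[i := s, j := t]" for s t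
  have len: "i < length Fs" "j < length Fs" "i \<noteq> j" using ij assms(2) by auto
  interpret Fi: ring "Fs ! i" using rings len by blast
  interpret Fj: ring "Fs ! j" using rings len by blast
  have nth: "w s t ! k = (if k = j then t else if k = i then s else \<zero>\<^bsub>Fs ! k\<^esub>)" if "k < length Fs" for s t k
    using that len unfolding w_def by (simp add: nth_list_update)
  have w_eq: "w s t = w s' t' \<longleftrightarrow> s = s' \<and> t = t'" for s t s' t'
    using nth[of i] nth[of j] len by metis
  have w_zero: "\<zero>\<^bsub>?P\<^esub> = w ?zi ?zj"
    unfolding RDirProd_list_zero_eq_map
    by (rule nth_equalityI) (use len nth in \<open>auto simp: w_def nth_list_update\<close>)
  have w_carr: "w s t \<in> carrier ?P" if "s \<in> carrier (Fs ! i)" "t \<in> carrier (Fs ! j)" for s t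
    using that rings by (intro RDirProd_list_carrier_memI) (auto simp: nth w_def[THEN arg_cong[where f = length]] ring.ring_simprules)
  have edge: "{g (w s t), g (w s' t')} \<in> edges (Reg_graph R)"
    if "s \<in> carrier (Fs ! i)" "t \<in> carrier (Fs ! j)" "s' \<in> carrier (Fs ! i)" "t' \<in> carrier (Fs ! j)"
      "s \<noteq> ?zi \<or> t \<noteq> ?zj" "s' \<noteq> ?zi \<or> t' \<noteq> ?zj" "s \<noteq> s' \<or> t \<noteq> t'"
      "s' \<otimes>\<^bsub>Fs ! i\<^esub> s \<otimes>\<^bsub>Fs ! i\<^esub> s' = s'" "t' \<otimes>\<^bsub>Fs ! j\<^esub> t \<otimes>\<^bsub>Fs ! j\<^esub> t' = t'" for s t s' t'
  proof (rule Reg_graph_edge_ring_iso[OF P R g])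
    show "w s' t' \<otimes>\<^bsub>?P\<^esub> w s t \<otimes>\<^bsub>?P\<^esub> w s' t' = w s' t'"
      using that(8,9) rings
      by (intro RDirProd_list_inner_inverse[OF rings w_carr[OF that(1,2)] w_carr[OF that(3,4)]])
        (auto simp: nth ring.ring_simprules)
  qed (use that w_carr w_zero w_eq in auto)
  have inj: "inj_on g (carrier ?P)"
    using g unfolding ring_iso_def bij_betw_def by blast
  \<comment> \<open>Both directions of the identity occur: it holds for the element with the smaller
    support, and along the cycle elements with one and with two nonzero coordinates
    alternate.\<close>
  have adj: "{g (w s t), g (w s' t')} \<in> edges (Reg_graph R)"
    if "s \<in> carrier (Fs ! i)" "t \<in> carrier (Fs ! j)" "s' \<in> carrier (Fs ! i)" "t' \<in> carrier (Fs ! j)"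
      "s \<noteq> ?zi \<or> t \<noteq> ?zj" "s' \<noteq> ?zi \<or> t' \<noteq> ?zj" "s \<noteq> s' \<or> t \<noteq> t'"
      "s' \<otimes>\<^bsub>Fs ! i\<^esub> s \<otimes>\<^bsub>Fs ! i\<^esub> s' = s' \<and> t' \<otimes>\<^bsub>Fs ! j\<^esub> t \<otimes>\<^bsub>Fs ! j\<^esub> t' = t' \<or>
       s \<otimes>\<^bsub>Fs ! i\<^esub> s' \<otimes>\<^bsub>Fs ! i\<^esub> s = s \<and> t \<otimes>\<^bsub>Fs ! j\<^esub> t' \<otimes>\<^bsub>Fs ! j\<^esub> t = t" for s t s' t'
    using edge[of s t s' t'] edge[of s' t' s t] that by (auto simp: insert_commute)
  \<comment> \<open>Cyclic neighbours have mutually inverse entries in their common nonzero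
    coordinate. Four steps along the cycle replace every nonzero entry by its inverse, which makes
    opposite elements adjacent.\<close>
  let ?vs = "[w u ?zj, w u' v', w ?zi v, w u v', w u' ?zj, w u v, w ?zi v', w u' v]"
  have "distinct ?vs" using u v by (auto simp: w_eq)
  moreover have "set ?vs \<subseteq> carrier ?P" using u v w_carr by auto
  ultimately have "distinct (map g ?vs)"
    using inj inj_on_subset distinct_map by blast
  then show ?thesis
    unfolding list.map
  proof (rule octagon_with_three_diagonals_not_planar[OF simple_graph_Reg_graph])
    show "path_edges [g (w u ?zj), g (w u' v'), g (w ?zi v), g (w u v'), g (w u' ?zj), g (w u v),
        g (w ?zi v'), g (w u' v), g (w u ?zj)] \<subseteq> edges (Reg_graph R)"
      unfolding path_edges.simps
      by (intro insert_subsetI empty_subsetI adj) (use u v in auto)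
  qed (rule adj; use u v in auto)+
qed

end
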